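(* Let $\mu$ be a positive Borel measure on $\mathbb{R}$ with finite moments of all orders, and let $(f,g)_0=\int_{\mathbb{R}} f(t)g(t)\,d\mu(t)$ for $f,g\in\mathcal{P}$. Suppose that $d\mu(t)=t^2\,d\mu_2(t)$, where $\mu_2$ is a positive measure with finite moments of all orders. Let $[\cdot,\cdot]_2$ be a double Geronimus transformation of $(\cdot,\cdot)_0$, and put $s_0^{**}=[1,1]_2$, $s_1^{**}=[1,t]_2=[t,1]_2$, $s_2^{**}=[t,t]_2$. Then $[\cdot,\cdot]_2$ admits the representation $$[f,g]_2=\int_{\mathbb{R}}f(t)g(t)\,d\mu_2(t)+\begin{pmatrix} f(0)& f'(0)\end{pmatrix}M\begin{pmatrix} g(0)\\ g'(0)\end{pmatrix},\qquad f,g\in\mathcal{P},$$ where $M$ is the symmetric matrix $$M=\begin{pmatrix} s_0^{**} &s_1^{**} \\ s_1^{**}& s_2^{**}\end{pmatrix}-\begin{pmatrix} \int_{\mathbb{R}}d\mu_2(t) &\int_{\mathbb{R}}t\,d\mu_2(t) \\ \int_{\mathbb{R}}t\,d\mu_2(t)& \int_{\mathbb{R}}t^2\,d\mu_2(t)\end{pmatrix}.$$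
   Context: $\mathcal{P}$ is the linear space of polynomials in one variable $t$ with real coefficients. A symmetric bilinear form on $\mathcal{P}$ is a map $B:\mathcal{P}\times\mathcal{P}\to\mathbb{R}$, linear in each argument, with $B(f,g)=B(g,f)$. A double Geronimus transformation of $(\cdot,\cdot)_0$ is any symmetric bilinear form $[\cdot,\cdot]_2$ on $\mathcal{P}$ such that $$[t^2f(t),g(t)]_2=[f(t),t^2g(t)]_2=(f,g)_0=\int_{\mathbb{R}} f(t)g(t)\,d\mu(t),\qquad f,g\in\mathcal{P}.$$ (This condition does not determine $[\cdot,\cdot]_2$ uniquely.) *)

theory Defs
  imports "HOL-Analysis.Analysis" "HOL-Computational_Algebra.Polynomial"
begin

definition borel_measure_finite_moments :: "real measure \<Rightarrow> bool" where
  "borel_measure_finite_moments \<mu> \<longleftrightarrow>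
     sets \<mu> = sets borel \<and> (\<forall>n::nat. integrable \<mu> (\<lambda>t. t ^ n))"

definition symmetric_bilinear_form :: "(real poly \<Rightarrow> real poly \<Rightarrow> real) \<Rightarrow> bool" where
  "symmetric_bilinear_form B \<longleftrightarrow>
     (\<forall>g. Vector_Spaces.linear smult (*) (\<lambda>f. B f g)) \<and>
     (\<forall>f. Vector_Spaces.linear smult (*) (\<lambda>g. B f g)) \<and>
     (\<forall>f g. B f g = B g f)"

definition integral_form :: "real measure \<Rightarrow> real poly \<Rightarrow> real poly \<Rightarrow> real" where
  "integral_form \<mu> f g = (\<integral>t. poly f t * poly g t \<partial>\<mu>)"

abbreviation var_t :: "real poly" where
  "var_t \<equiv> [:0, 1:]"

definition double_Geronimus_transformation ::
    "(real poly \<Rightarrow> real poly \<Rightarrow> real) \<Rightarrow> (real poly \<Rightarrow> real poly \<Rightarrow> real) \<Rightarrow> bool" where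
  "double_Geronimus_transformation B\<^sub>0 B \<longleftrightarrow>
     symmetric_bilinear_form B \<and>
     (\<forall>f g. B (var_t\<^sup>2 * f) g = B\<^sub>0 f g \<and> B f (var_t\<^sup>2 * g) = B\<^sub>0 f g)"

end

theory Submission
  imports Defs
begin

text \<open>
  The forms \<open>B\<close> and \<open>integral_form \<mu>\<^sub>2\<close> are both double Geronimus transformations of
  \<open>integral_form \<mu>\<close>: for the second one this says that \<open>t\<^sup>2 d\<mu>\<^sub>2 = d\<mu>\<close>. Hence their
  difference \<open>D\<close> is a symmetric bilinear form that vanishes as soon as one argument is a multiple of
  \<open>t\<^sup>2\<close>. Such a form factors through \<open>\<real>[t] / (t\<^sup>2)\<close>, in which a polynomial \<open>f\<close> is represented by its
  1-jet \<open>f(0) + f'(0) t\<close> at the origin, so \<open>D\<close> is given by its Gram matrix on \<open>1, t\<close>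
  (\<open>form_vanishing_on_square_multiples\<close>). That Gram matrix is \<open>M\<close>.
\<close>

lemma symmetric_bilinear_formD:
  assumes "symmetric_bilinear_form B"
  shows "B (f + h) g = B f g + B h g" "B (smult c f) g = c * B f g"
    and "B f (g + h) = B f g + B f h" "B f (smult c g) = c * B f g"
    and "B f g = B g f"
  using assms unfolding symmetric_bilinear_form_def Vector_Spaces.linear_iff by blast+

lemma symmetric_bilinear_formI:
  assumes "\<And>f h g. B (f + h) g = B f g + B h g"
    and "\<And>c f g. B (smult c f) g = c * B f g"
    and sym: "\<And>f g. B f g = B g f"
  shows "symmetric_bilinear_form B"
proof -
  have "vector_space (smult :: real \<Rightarrow> real poly \<Rightarrow> real poly)"
    by unfold_locales (simp_all add: smult_add_right smult_add_left)
  moreover have "vector_space ((*) :: real \<Rightarrow> real \<Rightarrow> real)"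
    by unfold_locales (simp_all add: algebra_simps)
  ultimately have "Vector_Spaces.linear smult (*) (\<lambda>f. B f g)" for g
    using assms(1,2) by (simp add: Vector_Spaces.linear_iff)
  moreover from this have "Vector_Spaces.linear smult (*) (\<lambda>f. B g f)" for g
    by (simp add: sym[of g])
  ultimately show ?thesis
    using sym unfolding symmetric_bilinear_form_def by blast
qed

lemma symmetric_bilinear_form_diff:
  assumes "symmetric_bilinear_form B" "symmetric_bilinear_form C"
  shows "symmetric_bilinear_form (\<lambda>f g. B f g - C f g)"
  using symmetric_bilinear_formD[OF assms(1)] symmetric_bilinear_formD[OF assms(2)]
  by (intro symmetric_bilinear_formI) (simp_all add: algebra_simps)

lemma integrable_poly:
  assumes "borel_measure_finite_moments \<nu>"
  shows "integrable \<nu> (poly p)"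
  using assms unfolding borel_measure_finite_moments_def poly_altdef[abs_def] by simp

lemma symmetric_bilinear_form_integral_form:
  assumes "borel_measure_finite_moments \<nu>"
  shows "symmetric_bilinear_form (integral_form \<nu>)"
proof (rule symmetric_bilinear_formI)
  have int: "integrable \<nu> (\<lambda>t. poly f t * poly g t)" for f g
    using integrable_poly[OF assms, of "f * g"] by (simp add: poly_mult[abs_def])
  show "integral_form \<nu> (f + h) g = integral_form \<nu> f g + integral_form \<nu> h g" for f h g
    using int by (simp add: integral_form_def distrib_right)
  show "integral_form \<nu> (smult c f) g = c * integral_form \<nu> f g" for c f g
    by (simp add: integral_form_def mult.assoc)
  show "integral_form \<nu> f g = integral_form \<nu> g f" for f g
    by (simp add: integral_form_def mult.commute)
qed

lemma integral_form_double_Geronimus: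
  assumes "borel_measure_finite_moments \<nu>"
  shows "double_Geronimus_transformation
           (integral_form (density \<nu> (\<lambda>t. ennreal (t\<^sup>2)))) (integral_form \<nu>)"
proof -
  have sets [measurable_cong]: "sets \<nu> = sets borel"
    using assms by (simp add: borel_measure_finite_moments_def)
  have [measurable]: "poly p \<in> borel_measurable \<nu>" for p
    using integrable_poly[OF assms] by (rule borel_measurable_integrable)
  have "integral_form (density \<nu> (\<lambda>t. ennreal (t\<^sup>2))) f g
          = (\<integral>t. t\<^sup>2 * (poly f t * poly g t) \<partial>\<nu>)" for f g
    unfolding integral_form_def by (subst integral_density) auto
  then show ?thesis
    unfolding double_Geronimus_transformation_def
    by (simp add: integral_form_def symmetric_bilinear_form_integral_form[OF assms] mult_ac)
qed

text \<open>
  Writing \<open>f = f(0) + f'(0) t + t\<^sup>2 q\<close>, the last term contributes nothing to \<open>D f g\<close>. Symmetry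
  gives the same reduction in the second argument.
\<close>

lemma form_vanishing_on_square_multiples:
  assumes form: "symmetric_bilinear_form D"
    and vanish: "\<And>f g. D (var_t\<^sup>2 * f) g = 0"
  shows "D f g = poly f 0 * (D 1 1 * poly g 0 + D 1 var_t * poly (pderiv g) 0)
               + poly (pderiv f) 0 * (D var_t 1 * poly g 0 + D var_t var_t * poly (pderiv g) 0)"
proof -
  note D = symmetric_bilinear_formD[OF form]
  have jet: "D f g = poly f 0 * D 1 g + poly (pderiv f) 0 * D var_t g" for f g
  proof -
    \<comment> \<open>The first two coefficients are the 1-jet; the remaining list of coefficients is \<open>q\<close>.\<close>
    obtain a b q where f: "f = pCons a (pCons b q)"
      by (metis pCons_cases)
    have "f = smult a 1 + smult b var_t + var_t\<^sup>2 * q"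
      by (simp add: f power2_eq_square one_pCons)
    then have "D f g = a * D 1 g + b * D var_t g"
      by (simp only: D(1,2) vanish)
    then show ?thesis
      by (simp add: f pderiv_pCons)
  qed
  have "D h g = D h 1 * poly g 0 + D h var_t * poly (pderiv g) 0" for h
    using jet[of g h] by (simp add: D(5)[of _ h] mult.commute)
  then show ?thesis
    using jet[of f g] by simp
qed

theorem proposition4p2:
  fixes \<mu> \<mu>\<^sub>2 :: "real measure"
    and B :: "real poly \<Rightarrow> real poly \<Rightarrow> real"
    and s\<^sub>0 s\<^sub>1 s\<^sub>2 :: real
    and M :: "real ^ 2 ^ 2"
  assumes "borel_measure_finite_moments \<mu>"
    and "borel_measure_finite_moments \<mu>\<^sub>2"
    and "\<mu> = density \<mu>\<^sub>2 (\<lambda>t. ennreal (t\<^sup>2))"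
    and "double_Geronimus_transformation (integral_form \<mu>) B"
    and "s\<^sub>0 = B 1 1" and "s\<^sub>1 = B 1 var_t" and "s\<^sub>2 = B var_t var_t"
    and "M = vector [vector [s\<^sub>0, s\<^sub>1], vector [s\<^sub>1, s\<^sub>2]]
           - vector [vector [\<integral>t. 1 \<partial>\<mu>\<^sub>2, \<integral>t. t \<partial>\<mu>\<^sub>2], vector [\<integral>t. t \<partial>\<mu>\<^sub>2, \<integral>t. t\<^sup>2 \<partial>\<mu>\<^sub>2]]"
  shows "s\<^sub>1 = B var_t 1 \<and> transpose M = M \<and>
      (\<forall>f g. B f g = (\<integral>t. poly f t * poly g t \<partial>\<mu>\<^sub>2)
           + (vector [poly f 0, poly (pderiv f) 0] :: real ^ 2)
             \<bullet> (M *v vector [poly g 0, poly (pderiv g) 0]))"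
proof (intro conjI allI)
  define D where "D = (\<lambda>f g. B f g - integral_form \<mu>\<^sub>2 f g)"
  have transB: "double_Geronimus_transformation (integral_form \<mu>) B"
    and transI: "double_Geronimus_transformation (integral_form \<mu>) (integral_form \<mu>\<^sub>2)"
    using assms(3,4) integral_form_double_Geronimus[OF assms(2)] by simp_all
  have D: "symmetric_bilinear_form D"
    using transB transI unfolding D_def double_Geronimus_transformation_def
    by (intro symmetric_bilinear_form_diff) auto
  have vanish: "D (var_t\<^sup>2 * f) g = 0" for f g
    using transB transI unfolding D_def double_Geronimus_transformation_def by simp
  have B_sym: "B f g = B g f" for f g
    using transB symmetric_bilinear_formD(5)
    unfolding double_Geronimus_transformation_def by blast
  show "s\<^sub>1 = B var_t 1"
    using assms(6) B_sym by simp
  have [simp]: "poly 1 = (\<lambda>t::real. 1)" "poly var_t = (\<lambda>t. t)"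
    by (simp_all add: fun_eq_iff)
  have M: "M $ 1 $ 1 = D 1 1" "M $ 1 $ 2 = D 1 var_t"
    "M $ 2 $ 1 = D var_t 1" "M $ 2 $ 2 = D var_t var_t"
    using assms(5-8) B_sym[of var_t 1]
    by (simp_all add: D_def integral_form_def power2_eq_square)
  show "transpose M = M"
    using symmetric_bilinear_formD(5)[OF D, of var_t 1]
    by (simp add: vec_eq_iff forall_2 transpose_def M)
  show "B f g = (\<integral>t. poly f t * poly g t \<partial>\<mu>\<^sub>2)
           + (vector [poly f 0, poly (pderiv f) 0] :: real ^ 2)
             \<bullet> (M *v vector [poly g 0, poly (pderiv g) 0])" for f g
  proof -
    have "B f g = integral_form \<mu>\<^sub>2 f g + D f g"
      by (simp add: D_def)
    also have "D f g = (vector [poly f 0, poly (pderiv f) 0] :: real ^ 2)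
                         \<bullet> (M *v vector [poly g 0, poly (pderiv g) 0])"
      unfolding form_vanishing_on_square_multiples[OF D vanish, of f g]
      by (simp add: inner_vec_def matrix_vector_mult_def sum_2 M)
    finally show ?thesis
      by (simp add: integral_form_def)
  qed
qed

end
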